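(* Let $\mathcal{B}$ be the free braided strict monoidal category on one object. The underlying monoidal category of $\mathcal{B}$ cannot be equipped with a symmetry; that is, there is no family of isomorphisms $\sigma_{A,B}:A\otimes B\to B\otimes A$ in $\mathcal{B}$ making the monoidal category $(\mathcal{B},\otimes,0)$ into a symmetric monoidal category.
   Context: Explicitly, $\mathcal{B}$ has as objects the natural numbers $0,1,2,\dots$; $\mathcal{B}(n,n)$ is the braid group on $n$ strands, with composition the group multiplication, and $\mathcal{B}(n,m)=\emptyset$ if $m\ne n$. The (strict) tensor product is addition on objects and juxtaposition of braids on morphisms, and the unit object is $0$. (Its canonical braiding $m+n\to n+m$ is the braid crossing $m$ strands past $n$ strands; only the underlying monoidal category matters here.) *)

theory Defs
  imports "HOL-Algebra.Group"
begin

section \<open>Categories, strict monoidal categories, symmetries\<close>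

locale category =
  fixes Obj :: "'o set"
    and Hom :: "'o \<Rightarrow> 'o \<Rightarrow> 'a set"
    and comp :: "'a \<Rightarrow> 'a \<Rightarrow> 'a"  (infixl "\<cdot>" 70)
    and ident :: "'o \<Rightarrow> 'a"
  assumes Hom_disjoint:
      "\<lbrakk>A \<in> Obj; B \<in> Obj; A' \<in> Obj; B' \<in> Obj; f \<in> Hom A B; f \<in> Hom A' B'\<rbrakk>
        \<Longrightarrow> A = A' \<and> B = B'"
    and ident_in_Hom: "A \<in> Obj \<Longrightarrow> ident A \<in> Hom A A"
    and comp_in_Hom:
      "\<lbrakk>A \<in> Obj; B \<in> Obj; C \<in> Obj; f \<in> Hom A B; g \<in> Hom B C\<rbrakk> \<Longrightarrow> g \<cdot> f \<in> Hom A C"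
    and comp_ident_right: "\<lbrakk>A \<in> Obj; B \<in> Obj; f \<in> Hom A B\<rbrakk> \<Longrightarrow> f \<cdot> ident A = f"
    and comp_ident_left: "\<lbrakk>A \<in> Obj; B \<in> Obj; f \<in> Hom A B\<rbrakk> \<Longrightarrow> ident B \<cdot> f = f"
    and comp_assoc:
      "\<lbrakk>A \<in> Obj; B \<in> Obj; C \<in> Obj; D \<in> Obj; f \<in> Hom A B; g \<in> Hom B C; h \<in> Hom C D\<rbrakk>
        \<Longrightarrow> (h \<cdot> g) \<cdot> f = h \<cdot> (g \<cdot> f)"
begin

definition iso :: "'o \<Rightarrow> 'o \<Rightarrow> 'a \<Rightarrow> bool" where
  "iso A B f \<longleftrightarrow> f \<in> Hom A B \<and> (\<exists>g \<in> Hom B A. g \<cdot> f = ident A \<and> f \<cdot> g = ident B)"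

end

locale strict_monoidal_category = category Obj Hom comp ident
  for Obj :: "'o set"
    and Hom :: "'o \<Rightarrow> 'o \<Rightarrow> 'a set"
    and comp :: "'a \<Rightarrow> 'a \<Rightarrow> 'a"  (infixl "\<cdot>" 70)
    and ident :: "'o \<Rightarrow> 'a" +
  fixes tensor_obj :: "'o \<Rightarrow> 'o \<Rightarrow> 'o"  (infixl "\<oslash>" 75)
    and tensor :: "'a \<Rightarrow> 'a \<Rightarrow> 'a"  (infixl "\<odot>" 75)
    and unit_obj :: 'o
  assumes unit_in_Obj: "unit_obj \<in> Obj"
    and tensor_in_Obj: "\<lbrakk>A \<in> Obj; B \<in> Obj\<rbrakk> \<Longrightarrow> A \<oslash> B \<in> Obj"
    and tensor_in_Hom:
      "\<lbrakk>A \<in> Obj; A' \<in> Obj; B \<in> Obj; B' \<in> Obj; f \<in> Hom A A'; g \<in> Hom B B'\<rbrakk>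
        \<Longrightarrow> f \<odot> g \<in> Hom (A \<oslash> B) (A' \<oslash> B')"
    and tensor_ident: "\<lbrakk>A \<in> Obj; B \<in> Obj\<rbrakk> \<Longrightarrow> ident A \<odot> ident B = ident (A \<oslash> B)"
    and interchange:
      "\<lbrakk>A \<in> Obj; A' \<in> Obj; A'' \<in> Obj; B \<in> Obj; B' \<in> Obj; B'' \<in> Obj;
        f \<in> Hom A A'; f' \<in> Hom A' A''; g \<in> Hom B B'; g' \<in> Hom B' B''\<rbrakk>
        \<Longrightarrow> (f' \<cdot> f) \<odot> (g' \<cdot> g) = (f' \<odot> g') \<cdot> (f \<odot> g)"
    and tensor_obj_assoc: "\<lbrakk>A \<in> Obj; B \<in> Obj; C \<in> Obj\<rbrakk> \<Longrightarrow> (A \<oslash> B) \<oslash> C = A \<oslash> (B \<oslash> C)"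
    and tensor_obj_unit: "A \<in> Obj \<Longrightarrow> unit_obj \<oslash> A = A \<and> A \<oslash> unit_obj = A"
    and tensor_assoc:
      "\<lbrakk>A \<in> Obj; A' \<in> Obj; B \<in> Obj; B' \<in> Obj; C \<in> Obj; C' \<in> Obj;
        f \<in> Hom A A'; g \<in> Hom B B'; h \<in> Hom C C'\<rbrakk>
        \<Longrightarrow> (f \<odot> g) \<odot> h = f \<odot> (g \<odot> h)"
    and tensor_unit:
      "\<lbrakk>A \<in> Obj; A' \<in> Obj; f \<in> Hom A A'\<rbrakk>
        \<Longrightarrow> ident unit_obj \<odot> f = f \<and> f \<odot> ident unit_obj = f"

text \<open>
  The hexagon axioms below have their associators omitted, since these are identities. The unit
  conditions \<open>\<sigma> A unit_obj = ident A = \<sigma> unit_obj A\<close> are not listed, being consequences of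
  the hexagons and invertibility.
\<close>

locale symmetric_strict_monoidal_category =
  strict_monoidal_category Obj Hom comp ident tensor_obj tensor unit_obj
  for Obj :: "'o set"
    and Hom :: "'o \<Rightarrow> 'o \<Rightarrow> 'a set"
    and comp :: "'a \<Rightarrow> 'a \<Rightarrow> 'a"  (infixl "\<cdot>" 70)
    and ident :: "'o \<Rightarrow> 'a"
    and tensor_obj :: "'o \<Rightarrow> 'o \<Rightarrow> 'o"  (infixl "\<oslash>" 75)
    and tensor :: "'a \<Rightarrow> 'a \<Rightarrow> 'a"  (infixl "\<odot>" 75)
    and unit_obj :: 'o +
  fixes \<sigma> :: "'o \<Rightarrow> 'o \<Rightarrow> 'a"
  assumes sym_iso: "\<lbrakk>A \<in> Obj; B \<in> Obj\<rbrakk> \<Longrightarrow> iso (A \<oslash> B) (B \<oslash> A) (\<sigma> A B)"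
    and sym_natural:
      "\<lbrakk>A \<in> Obj; A' \<in> Obj; B \<in> Obj; B' \<in> Obj; f \<in> Hom A A'; g \<in> Hom B B'\<rbrakk>
        \<Longrightarrow> \<sigma> A' B' \<cdot> (f \<odot> g) = (g \<odot> f) \<cdot> \<sigma> A B"
    and hexagon1:
      "\<lbrakk>A \<in> Obj; B \<in> Obj; C \<in> Obj\<rbrakk>
        \<Longrightarrow> \<sigma> A (B \<oslash> C) = (ident B \<odot> \<sigma> A C) \<cdot> (\<sigma> A B \<odot> ident C)"
    and hexagon2:
      "\<lbrakk>A \<in> Obj; B \<in> Obj; C \<in> Obj\<rbrakk>
        \<Longrightarrow> \<sigma> (A \<oslash> B) C = (\<sigma> A C \<odot> ident B) \<cdot> (ident A \<odot> \<sigma> B C)"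
    and sym_involutive:
      "\<lbrakk>A \<in> Obj; B \<in> Obj\<rbrakk> \<Longrightarrow> \<sigma> B A \<cdot> \<sigma> A B = ident (A \<oslash> B)"


section \<open>Braid groups\<close>

text \<open>
  Artin's presentation. The letters \<open>(i, True)\<close> and \<open>(i, False)\<close> stand for the generator
  that crosses the strands at positions \<open>i\<close> and \<open>i + 1\<close>, counted from 0, and for its
  inverse.
\<close>

type_synonym braid_word = "(nat \<times> bool) list"

definition braid_words :: "nat \<Rightarrow> braid_word set" where
  "braid_words n = lists {(i, e). Suc i < n}"

inductive braid_eq :: "nat \<Rightarrow> braid_word \<Rightarrow> braid_word \<Rightarrow> bool" for n where
  refl: "w \<in> braid_words n \<Longrightarrow> braid_eq n w w"
| sym: "braid_eq n u v \<Longrightarrow> braid_eq n v u"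
| trans: "braid_eq n u v \<Longrightarrow> braid_eq n v w \<Longrightarrow> braid_eq n u w"
| append: "braid_eq n u u' \<Longrightarrow> braid_eq n v v' \<Longrightarrow> braid_eq n (u @ v) (u' @ v')"
| cancel: "Suc i < n \<Longrightarrow> braid_eq n [(i, e), (i, \<not> e)] []"
| far: "Suc i < j \<Longrightarrow> Suc j < n
    \<Longrightarrow> braid_eq n [(i, True), (j, True)] [(j, True), (i, True)]"
| braid: "Suc (Suc i) < n
    \<Longrightarrow> braid_eq n [(i, True), (Suc i, True), (i, True)] [(Suc i, True), (i, True), (Suc i, True)]"

definition braid_rel :: "nat \<Rightarrow> (braid_word \<times> braid_word) set" where
  "braid_rel n = {(u, v). braid_eq n u v}"

definition braid_class :: "nat \<Rightarrow> braid_word \<Rightarrow> braid_word set" where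
  "braid_class n w = braid_rel n `` {w}"

definition braid_group :: "nat \<Rightarrow> braid_word set monoid" where
  "braid_group n =
    \<lparr>carrier = braid_words n // braid_rel n,
     mult = (\<lambda>X Y. \<Union>x\<in>X. \<Union>y\<in>Y. braid_class n (x @ y)),
     one = braid_class n []\<rparr>"

definition shift_word :: "nat \<Rightarrow> braid_word \<Rightarrow> braid_word" where
  "shift_word m w = map (\<lambda>(i, e). (m + i, e)) w"

definition juxtapose :: "nat \<Rightarrow> nat \<Rightarrow> braid_word set \<Rightarrow> braid_word set \<Rightarrow> braid_word set" where
  "juxtapose m n X Y = (\<Union>x\<in>X. \<Union>y\<in>Y. braid_class (m + n) (x @ shift_word m y))"


section \<open>The braid category\<close>

text \<open>
  The underlying monoidal category of the free braided strict monoidal category on one object, in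
  the explicit description by braid groups; tensor on objects is \<open>(+)\<close>, with unit 0. The
  number of strands is part of an arrow, because braid groups on different numbers of strands
  can share elements as sets (the groups on 0 and on 1 strands are equal).
\<close>

type_synonym braid_arrow = "nat \<times> braid_word set"

definition braid_Obj :: "nat set" where
  "braid_Obj = UNIV"

definition braid_Hom :: "nat \<Rightarrow> nat \<Rightarrow> braid_arrow set" where
  "braid_Hom n m = (if m = n then {n} \<times> carrier (braid_group n) else {})"

definition braid_comp :: "braid_arrow \<Rightarrow> braid_arrow \<Rightarrow> braid_arrow" where
  "braid_comp g f = (fst g, snd g \<otimes>\<^bsub>braid_group (fst g)\<^esub> snd f)"

definition braid_ident :: "nat \<Rightarrow> braid_arrow" where
  "braid_ident n = (n, \<one>\<^bsub>braid_group n\<^esub>)"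

definition braid_tensor :: "braid_arrow \<Rightarrow> braid_arrow \<Rightarrow> braid_arrow" where
  "braid_tensor f g = (fst f + fst g, juxtapose (fst f) (fst g) (snd f) (snd g))"


section \<open>The braid category is a strict monoidal category\<close>

lemma braid_eq_words: "braid_eq n u v \<Longrightarrow> u \<in> braid_words n \<and> v \<in> braid_words n"
  by (induction rule: braid_eq.induct) (auto simp: braid_words_def)

lemma equiv_braid_rel: "equiv (braid_words n) (braid_rel n)"
  unfolding braid_rel_def
proof (rule equivI)
  show "{(u, v). braid_eq n u v} \<subseteq> braid_words n \<times> braid_words n"
    using braid_eq_words by blast
  show "refl_on (braid_words n) {(u, v). braid_eq n u v}"
    by (simp add: refl_on_def braid_eq.refl)
  show "sym {(u, v). braid_eq n u v}"
    using braid_eq.sym by (blast intro: symI)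
  show "trans {(u, v). braid_eq n u v}"
    using braid_eq.trans by (blast intro: transI)
qed

lemma mem_braid_class: "v \<in> braid_class n u \<longleftrightarrow> braid_eq n u v"
  by (simp add: braid_class_def braid_rel_def)

lemma braid_class_eqI:
  assumes "braid_eq n u v"
  shows "braid_class n u = braid_class n v"
proof (rule Set.set_eqI)
  fix w
  show "w \<in> braid_class n u \<longleftrightarrow> w \<in> braid_class n v"
    unfolding mem_braid_class
    using braid_eq.trans[OF assms] braid_eq.trans[OF braid_eq.sym[OF assms]] by blast
qed

lemma carrier_braid_group: "carrier (braid_group n) = braid_class n ` braid_words n"
  by (auto simp: braid_group_def quotient_def braid_class_def)

lemma one_braid_group: "\<one>\<^bsub>braid_group n\<^esub> = braid_class n []"
  by (simp add: braid_group_def)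

lemma braid_words_append [simp]:
  "u @ v \<in> braid_words n \<longleftrightarrow> u \<in> braid_words n \<and> v \<in> braid_words n"
  by (auto simp: braid_words_def)

lemma braid_words_Nil [simp]: "[] \<in> braid_words n"
  by (simp add: braid_words_def)

lemma UN_UN_const:
  assumes "a \<in> X" "b \<in> Y" "\<And>x y. \<lbrakk>x \<in> X; y \<in> Y\<rbrakk> \<Longrightarrow> F x y = c"
  shows "(\<Union>x\<in>X. \<Union>y\<in>Y. F x y) = c"
proof -
  have "(\<Union>x\<in>X. \<Union>y\<in>Y. F x y) = (\<Union>x\<in>X. \<Union>y\<in>Y. c)"
    by (intro SUP_cong HOL.refl assms(3))
  also have "\<dots> = c"
    using assms(1,2) by blast
  finally show ?thesis .
qed

lemma mult_braid_class:
  assumes "u \<in> braid_words n" "v \<in> braid_words n"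
  shows "braid_class n u \<otimes>\<^bsub>braid_group n\<^esub> braid_class n v = braid_class n (u @ v)"
proof -
  have c: "braid_class n (x @ y) = braid_class n (u @ v)" if "braid_eq n u x" "braid_eq n v y" for x y
    using braid_class_eqI[OF braid_eq.append[OF that]] by (rule HOL.sym)
  have m: "u \<in> braid_class n u" "v \<in> braid_class n v"
    using assms by (simp_all add: mem_braid_class braid_eq.refl)
  have "(\<Union>x\<in>braid_class n u. \<Union>y\<in>braid_class n v. braid_class n (x @ y)) = braid_class n (u @ v)"
    by (rule UN_UN_const[OF m]) (simp only: mem_braid_class c)
  then show ?thesis
    by (simp add: braid_group_def)
qed

definition inv_word :: "braid_word \<Rightarrow> braid_word" where
  "inv_word w = rev (map (\<lambda>(i, e). (i, \<not> e)) w)"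

lemma inv_word_words: "w \<in> braid_words n \<Longrightarrow> inv_word w \<in> braid_words n"
  by (auto simp: inv_word_def braid_words_def)

lemma braid_eq_inv_word: "w \<in> braid_words n \<Longrightarrow> braid_eq n (inv_word w @ w) []"
proof (induction w)
  case Nil
  then show ?case by (simp add: inv_word_def braid_eq.refl)
next
  case (Cons a w)
  obtain i e where a: "a = (i, e)" by (cases a)
  have i: "Suc i < n" and w: "w \<in> braid_words n"
    using Cons.prems a by (auto simp: braid_words_def)
  have "braid_eq n ([(i, \<not> e), (i, \<not> \<not> e)] @ w) ([] @ w)"
    using i w by (intro braid_eq.append braid_eq.cancel braid_eq.refl)
  then have "braid_eq n (inv_word w @ ([(i, \<not> e), (i, e)] @ w)) (inv_word w @ w)"
    using braid_eq.append[OF braid_eq.refl[OF inv_word_words[OF w]]] by simp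
  then have "braid_eq n (inv_word w @ ([(i, \<not> e), (i, e)] @ w)) []"
    using Cons.IH[OF w] by (rule braid_eq.trans)
  then show ?case
    by (simp add: inv_word_def a)
qed

lemma group_braid_group: "group (braid_group n)"
proof (rule groupI)
  fix x assume "x \<in> carrier (braid_group n)"
  then obtain u where u: "u \<in> braid_words n" "x = braid_class n u"
    by (auto simp: carrier_braid_group)
  show "\<exists>y\<in>carrier (braid_group n). y \<otimes>\<^bsub>braid_group n\<^esub> x = \<one>\<^bsub>braid_group n\<^esub>"
  proof (rule bexI[of _ "braid_class n (inv_word u)"])
    show "braid_class n (inv_word u) \<otimes>\<^bsub>braid_group n\<^esub> x = \<one>\<^bsub>braid_group n\<^esub>"
      using u inv_word_words[OF u(1)] braid_eq_inv_word[OF u(1)]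
      by (simp add: mult_braid_class one_braid_group braid_class_eqI)
  qed (use inv_word_words[OF u(1)] in \<open>simp add: carrier_braid_group\<close>)
qed (auto simp: carrier_braid_group mult_braid_class one_braid_group)

lemma shift_word_append: "shift_word m (u @ v) = shift_word m u @ shift_word m v"
  by (simp add: shift_word_def)

lemma shift_word_words: "v \<in> braid_words n \<Longrightarrow> shift_word m v \<in> braid_words (m + n)"
  by (auto simp: shift_word_def braid_words_def lists_eq_set subset_iff)

lemma braid_words_mono: "v \<in> braid_words m \<Longrightarrow> v \<in> braid_words (m + n)"
  by (auto simp: braid_words_def)

lemma braid_eq_mono: "braid_eq m u v \<Longrightarrow> braid_eq (m + n) u v"
proof (induction rule: braid_eq.induct)
  case (trans u v w)
  then show ?case by (blast intro: braid_eq.trans)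
next
  case (sym u v)
  then show ?case by (blast intro: braid_eq.sym)
qed (auto intro: braid_eq.refl braid_eq.append braid_eq.cancel braid_eq.far
  braid_eq.braid braid_words_mono)

lemma braid_eq_shift: "braid_eq n u v \<Longrightarrow> braid_eq (m + n) (shift_word m u) (shift_word m v)"
proof (induction rule: braid_eq.induct)
  case (trans u v w)
  then show ?case by (blast intro: braid_eq.trans)
next
  case (append u u' v v')
  then show ?case by (simp add: shift_word_append braid_eq.append)
next
  case (cancel i e)
  then show ?case using braid_eq.cancel[of "m + i" "m + n" e] by (simp add: shift_word_def)
next
  case (far i j)
  then show ?case using braid_eq.far[of "m + i" "m + j" "m + n"] by (simp add: shift_word_def)
next
  case (braid i)
  then show ?case using braid_eq.braid[of "m + i" "m + n"] by (simp add: shift_word_def)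
next
  case (sym u v)
  then show ?case by (blast intro: braid_eq.sym)
qed (auto intro: braid_eq.refl shift_word_words)

lemma juxtapose_braid_class:
  assumes "u \<in> braid_words m" "v \<in> braid_words n"
  shows "juxtapose m n (braid_class m u) (braid_class n v)
    = braid_class (m + n) (u @ shift_word m v)"
proof -
  have c: "braid_class (m + n) (x @ shift_word m y) = braid_class (m + n) (u @ shift_word m v)"
    if "braid_eq m u x" "braid_eq n v y" for x y
    by (rule HOL.sym, rule braid_class_eqI)
       (rule braid_eq.append[OF braid_eq_mono[OF that(1)] braid_eq_shift[OF that(2)]])
  have m: "u \<in> braid_class m u" "v \<in> braid_class n v"
    using assms by (simp_all add: mem_braid_class braid_eq.refl)
  show ?thesis
    unfolding juxtapose_def by (rule UN_UN_const[OF m]) (simp only: mem_braid_class c)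
qed

lemma braid_eq_insert_cancel:
  assumes "u \<in> braid_words n" "v \<in> braid_words n" "Suc i < n"
  shows "braid_eq n (u @ [(i, e), (i, \<not> e)] @ v) (u @ v)"
  using assms braid_eq.append[OF braid_eq.refl[OF assms(1)]
    braid_eq.append[OF braid_eq.cancel[OF assms(3), of e] braid_eq.refl[OF assms(2)]]]
  by simp

lemma commute_inverse:
  assumes i: "Suc i < n" and v: "v \<in> braid_words n"
    and c: "braid_eq n ([(i, e)] @ v) (v @ [(i, e)])"
  shows "braid_eq n ([(i, \<not> e)] @ v) (v @ [(i, \<not> e)])"
proof -
  have w: "[(i, b)] \<in> braid_words n" for b
    using i by (simp add: braid_words_def)
  have wv: "(i, \<not> e) # v \<in> braid_words n"
    using i v by (simp add: braid_words_def)
  have 1: "braid_eq n ([(i, \<not> e)] @ v) ([(i, \<not> e)] @ v @ [(i, e), (i, \<not> e)])"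
    using braid_eq.sym[OF braid_eq_insert_cancel[of "[(i, \<not> e)] @ v" n "[]" i e]] wv i
    by simp
  have 2: "braid_eq n ([(i, \<not> e)] @ (v @ [(i, e)]) @ [(i, \<not> e)])
      ([(i, \<not> e)] @ ([(i, e)] @ v) @ [(i, \<not> e)])"
    by (intro braid_eq.append braid_eq.refl w braid_eq.sym[OF c])
  have 3: "braid_eq n ([(i, \<not> e)] @ ([(i, e)] @ v) @ [(i, \<not> e)]) (v @ [(i, \<not> e)])"
    using braid_eq_insert_cancel[of "[]" n "v @ [(i, \<not> e)]" i "\<not> e"] w v i by simp
  have "braid_eq n ([(i, \<not> e)] @ v) ([(i, \<not> e)] @ (v @ [(i, e)]) @ [(i, \<not> e)])"
    using 1 by simp
  then show ?thesis
    by (rule braid_eq.trans[OF _ braid_eq.trans[OF 2 3]])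
qed

lemma far_commute:
  assumes "Suc i < j" "Suc j < n"
  shows "braid_eq n [(i, e), (j, d)] [(j, d), (i, e)]"
proof -
  have w: "[(i, b)] \<in> braid_words n" "[(j, b)] \<in> braid_words n" for b
    using assms by (auto simp: braid_words_def)
  have 1: "braid_eq n ([(i, e)] @ [(j, True)]) ([(j, True)] @ [(i, e)])"
    using braid_eq.far[OF assms] commute_inverse[of i n "[(j, True)]" True] w assms
    by (cases e) auto
  then have "braid_eq n ([(j, True)] @ [(i, e)]) ([(i, e)] @ [(j, True)])"
    by (rule braid_eq.sym)
  then have "braid_eq n ([(j, d)] @ [(i, e)]) ([(i, e)] @ [(j, d)])"
    using commute_inverse[of j n "[(i, e)]" True] w assms by (cases d) auto
  then show ?thesis
    using braid_eq.sym by simp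
qed

lemma shift_commute_letter:
  assumes "v \<in> braid_words n" "Suc i < m"
  shows "braid_eq (m + n) ([(i, e)] @ shift_word m v) (shift_word m v @ [(i, e)])"
  using assms(1)
proof (induction v)
  case Nil
  then show ?case
    using assms(2) by (auto simp: shift_word_def braid_words_def intro: braid_eq.refl)
next
  case (Cons a v)
  obtain j d where a: "a = (j, d)" by (cases a)
  have j: "Suc j < n" and v: "v \<in> braid_words n"
    using Cons.prems a by (auto simp: braid_words_def)
  have "braid_eq (m + n) [(i, e), (m + j, d)] [(m + j, d), (i, e)]"
    using assms(2) j by (intro far_commute) auto
  then have 1: "braid_eq (m + n) ([(i, e), (m + j, d)] @ shift_word m v)
      ([(m + j, d), (i, e)] @ shift_word m v)"
    by (intro braid_eq.append braid_eq.refl shift_word_words v)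
  have 2: "braid_eq (m + n) ([(m + j, d)] @ ([(i, e)] @ shift_word m v))
      ([(m + j, d)] @ (shift_word m v @ [(i, e)]))"
    using j by (intro braid_eq.append braid_eq.refl Cons.IH v) (auto simp: braid_words_def)
  have "braid_eq (m + n) ([(i, e), (m + j, d)] @ shift_word m v)
      ([(m + j, d)] @ (shift_word m v @ [(i, e)]))"
    using 1 2 by (simp add: braid_eq.trans[of _ _ "(m + j, d) # (i, e) # shift_word m v"])
  then show ?case
    by (simp add: shift_word_def a)
qed

lemma shift_commute:
  assumes "u \<in> braid_words m" "v \<in> braid_words n"
  shows "braid_eq (m + n) (u @ shift_word m v) (shift_word m v @ u)"
  using assms(1)
proof (induction u)
  case Nil
  then show ?case using shift_word_words[OF assms(2)] by (auto intro: braid_eq.refl)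
next
  case (Cons a u)
  obtain i e where a: "a = (i, e)" by (cases a)
  have i: "Suc i < m" and u: "u \<in> braid_words m"
    using Cons.prems a by (auto simp: braid_words_def)
  have 1: "braid_eq (m + n) ([a] @ (u @ shift_word m v)) ([a] @ (shift_word m v @ u))"
    using i by (intro braid_eq.append braid_eq.refl Cons.IH u) (auto simp: braid_words_def a)
  have 2: "braid_eq (m + n) (([a] @ shift_word m v) @ u) ((shift_word m v @ [a]) @ u)"
    unfolding a
    by (intro braid_eq.append braid_eq.refl shift_commute_letter assms(2) i braid_words_mono u)
  from 1 have "braid_eq (m + n) ([a] @ (u @ shift_word m v)) (([a] @ shift_word m v) @ u)"
    by simp
  then have "braid_eq (m + n) ([a] @ (u @ shift_word m v)) ((shift_word m v @ [a]) @ u)"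
    by (rule braid_eq.trans[OF _ 2])
  then show ?case
    by simp
qed

lemma braid_HomE:
  assumes "f \<in> braid_Hom n m"
  obtains u where "u \<in> braid_words n" "m = n" "f = (n, braid_class n u)"
  using assms by (auto simp: braid_Hom_def carrier_braid_group split: if_splits)

lemma braid_HomI: "u \<in> braid_words n \<Longrightarrow> (n, braid_class n u) \<in> braid_Hom n n"
  by (auto simp: braid_Hom_def carrier_braid_group)

lemma braid_comp_class:
  "\<lbrakk>u \<in> braid_words n; v \<in> braid_words n\<rbrakk>
    \<Longrightarrow> braid_comp (n, braid_class n u) (n, braid_class n v) = (n, braid_class n (u @ v))"
  by (simp add: braid_comp_def mult_braid_class)

lemma braid_tensor_class:
  "\<lbrakk>u \<in> braid_words m; v \<in> braid_words n\<rbrakk>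
    \<Longrightarrow> braid_tensor (m, braid_class m u) (n, braid_class n v)
      = (m + n, braid_class (m + n) (u @ shift_word m v))"
  by (simp add: braid_tensor_def juxtapose_braid_class)

lemma shift_word_shift_word: "shift_word m (shift_word n w) = shift_word (m + n) w"
  by (auto simp: shift_word_def)

lemma shift_word_0: "shift_word 0 w = w"
  by (induction w) (auto simp: shift_word_def)

lemma shift_word_Nil: "shift_word m [] = []"
  by (simp add: shift_word_def)

lemma braid_words_0: "w \<in> braid_words 0 \<longleftrightarrow> w = []"
  by (cases w) (auto simp: braid_words_def)

theorem braid_strict_monoidal_category:
  "strict_monoidal_category braid_Obj braid_Hom braid_comp braid_ident (+) braid_tensor 0"
proof unfold_locales
  fix A A' A'' B B' B'' :: nat and f f' g g'
  assume "f \<in> braid_Hom A A'" "f' \<in> braid_Hom A' A''" "g \<in> braid_Hom B B'" "g' \<in> braid_Hom B' B''"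
  then obtain u u' v v' where
    e: "f = (A, braid_class A u)" "f' = (A, braid_class A u')"
      "g = (B, braid_class B v)" "g' = (B, braid_class B v')"
    and w: "u \<in> braid_words A" "u' \<in> braid_words A" "v \<in> braid_words B" "v' \<in> braid_words B"
    by (elim braid_HomE) auto
  have "braid_eq (A + B) (u' @ (u @ shift_word A v') @ shift_word A v)
      (u' @ (shift_word A v' @ u) @ shift_word A v)"
    by (intro braid_eq.append braid_eq.refl shift_commute shift_word_words braid_words_mono w)
  then show "braid_tensor (braid_comp f' f) (braid_comp g' g)
      = braid_comp (braid_tensor f' g') (braid_tensor f g)"
    using w
    by (simp add: e braid_comp_class braid_tensor_class braid_words_mono shift_word_words
        shift_word_append braid_class_eqI)
next
  fix A A' B B' C C' :: nat and f g h
  assume "f \<in> braid_Hom A A'" "g \<in> braid_Hom B B'" "h \<in> braid_Hom C C'"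
  then show "braid_tensor (braid_tensor f g) h = braid_tensor f (braid_tensor g h)"
    by (elim braid_HomE)
       (simp add: braid_tensor_class braid_words_mono shift_word_words
        shift_word_append shift_word_shift_word add.assoc)
next
  fix A A' B B' :: nat and f g
  assume "f \<in> braid_Hom A A'" "g \<in> braid_Hom B B'"
  then show "braid_tensor f g \<in> braid_Hom (A + B) (A' + B')"
    by (elim braid_HomE)
       (simp add: braid_tensor_class braid_HomI braid_words_mono shift_word_words)
next
  fix A B C D :: nat and f g h
  assume "f \<in> braid_Hom A B" "g \<in> braid_Hom B C" "h \<in> braid_Hom C D"
  then show "braid_comp (braid_comp h g) f = braid_comp h (braid_comp g f)"
    by (elim braid_HomE) (simp add: braid_comp_class)
next
  fix A B C :: nat and f g
  assume "f \<in> braid_Hom A B" "g \<in> braid_Hom B C"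
  then show "braid_comp g f \<in> braid_Hom A C"
    by (elim braid_HomE) (simp add: braid_comp_class braid_HomI)
next
  fix A A' :: nat and f
  assume "f \<in> braid_Hom A A'"
  then show "braid_tensor (braid_ident 0) f = f \<and> braid_tensor f (braid_ident 0) = f"
    by (elim braid_HomE)
       (simp add: braid_ident_def one_braid_group braid_tensor_class shift_word_0 shift_word_Nil)
qed (auto elim!: braid_HomE simp: braid_Obj_def braid_ident_def one_braid_group braid_comp_class
    braid_tensor_class shift_word_Nil intro: braid_HomI)

end

theory Submission
  imports Defs "HOL-Combinatorics.Transposition"
begin

text \<open>
  The group on two strands is infinite cyclic, hence torsion-free, so a symmetry has
  \<open>\<sigma> 1 1 = 1\<close>, and by the hexagon \<open>\<sigma> 1 2 = 1\<close>. Naturality of \<open>\<sigma> 1 2\<close> at the crossing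
  of the last two strands then identifies the two generators of the group on three strands, which
  have different images in the symmetric group.
\<close>

lemma braid_class_eqD:
  assumes "braid_class n u = braid_class n v" "v \<in> braid_words n"
  shows "braid_eq n u v"
proof -
  have "v \<in> braid_class n v"
    using assms(2) by (simp add: mem_braid_class braid_eq.refl)
  then show ?thesis
    unfolding assms(1)[symmetric] mem_braid_class .
qed

text \<open>The underlying permutation of a braid. The sign of a letter is dropped because a
  transposition is its own inverse.\<close>

definition braid_perm :: "braid_word \<Rightarrow> nat \<Rightarrow> nat" where
  "braid_perm w = foldr (\<lambda>(i, e) p. transpose i (Suc i) \<circ> p) w id"

lemma braid_perm_Nil [simp]: "braid_perm [] = id"
  by (simp add: braid_perm_def)

lemma braid_perm_Cons [simp]: "braid_perm ((i, e) # w) = transpose i (Suc i) \<circ> braid_perm w"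
  by (simp add: braid_perm_def)

lemma braid_perm_append: "braid_perm (u @ v) = braid_perm u \<circ> braid_perm v"
  by (induction u) auto

text \<open>Adjacent transpositions satisfy the relations \<open>cancel\<close>, \<open>far\<close>
  and \<open>braid\<close>. This invariant will separate the two generators on three
  strands.\<close>

lemma braid_eq_imp_braid_perm_eq: "braid_eq n u v \<Longrightarrow> braid_perm u = braid_perm v"
  by (induction rule: braid_eq.induct)
     (auto simp: braid_perm_append fun_eq_iff transpose_def)

text \<open>The homomorphism to the integers that sends every generator to 1. On two strands it
  recovers the exponent of a power of the generator.\<close>

definition exponent_sum :: "braid_word \<Rightarrow> int" where
  "exponent_sum w = (\<Sum>(i, e)\<leftarrow>w. if e then 1 else - 1)"

lemma exponent_sum_append: "exponent_sum (u @ v) = exponent_sum u + exponent_sum v"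
  by (simp add: exponent_sum_def)

lemma exponent_sum_replicate:
  "exponent_sum (replicate k (i, e)) = (if e then int k else - int k)"
  by (simp add: exponent_sum_def sum_list_replicate)

lemma braid_eq_imp_exponent_sum_eq: "braid_eq n u v \<Longrightarrow> exponent_sum u = exponent_sum v"
  by (induction rule: braid_eq.induct) (auto simp: exponent_sum_def)

text \<open>On two strands the only letters are the generator at position 0 and its inverse, so
  cancellation reduces any word to a power; \<open>k\<close> and \<open>e\<close> are the absolute
  value and the sign of the exponent.\<close>

lemma braid_eq_2_replicate:
  assumes "w \<in> braid_words 2"
  shows "\<exists>k e. braid_eq 2 w (replicate k (0, e))"
  using assms
proof (induction w)
  case Nil
  then have "braid_eq 2 [] (replicate 0 (0, True))"
    by (simp add: braid_eq.refl)
  then show ?case by blast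
next
  case (Cons a w)
  obtain d where a: "a = (0, d)" and w: "w \<in> braid_words 2"
    using Cons.prems by (cases a) (auto simp: braid_words_def)
  have words: "replicate k (0, e) \<in> braid_words 2" for k e
    by (auto simp: braid_words_def)
  obtain k e where "braid_eq 2 w (replicate k (0, e))"
    using Cons.IH[OF w] by blast
  then have ke: "braid_eq 2 (a # w) ((0, d) # replicate k (0, e))"
    using braid_eq.append[OF braid_eq.refl[OF words[of 1 d]]] a by simp
  \<comment> \<open>A new letter lengthens a power of the same sign, or the empty power, whose sign
    is arbitrary; otherwise it cancels the first letter.\<close>
  show ?case
  proof (cases "d = e \<or> k = 0")
    case True
    then have "(0, d) # replicate k (0, e) = replicate (Suc k) (0, d)"
      by auto
    then show ?thesis using ke by metis
  next
    case False
    then obtain l where l: "k = Suc l" and e: "e = (\<not> d)"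
      by (cases k) auto
    have "braid_eq 2 ((0, d) # replicate k (0, e)) (replicate l (0, e))"
      using braid_eq_insert_cancel[OF braid_words_Nil words, where i = 0 and e = d] by (simp add: l e)
    then show ?thesis using braid_eq.trans[OF ke] by blast
  qed
qed

text \<open>Torsion-freeness for squares: the exponent sum doubles under squaring, so it vanishes,
  and a power with exponent sum 0 is the empty word.\<close>

lemma braid_eq_2_square:
  assumes "w \<in> braid_words 2" "braid_eq 2 (w @ w) []"
  shows "braid_eq 2 w []"
proof -
  obtain k e where ke: "braid_eq 2 w (replicate k (0, e))"
    using braid_eq_2_replicate[OF assms(1)] by blast
  have "exponent_sum w + exponent_sum w = exponent_sum []"
    using braid_eq_imp_exponent_sum_eq[OF assms(2)] by (simp add: exponent_sum_append)
  then have "exponent_sum w = 0"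
    by (simp add: exponent_sum_def)
  then have "k = 0"
    using braid_eq_imp_exponent_sum_eq[OF ke] by (simp add: exponent_sum_replicate split: if_splits)
  then show ?thesis using ke by simp
qed

theorem proposition3p1:
  shows "\<not> (\<exists>\<sigma> :: nat \<Rightarrow> nat \<Rightarrow> braid_arrow.
    symmetric_strict_monoidal_category braid_Obj braid_Hom braid_comp braid_ident (+) braid_tensor 0 \<sigma>)"
proof
  assume "\<exists>\<sigma> :: nat \<Rightarrow> nat \<Rightarrow> braid_arrow.
    symmetric_strict_monoidal_category braid_Obj braid_Hom braid_comp braid_ident (+) braid_tensor 0 \<sigma>"
  then obtain \<sigma> :: "nat \<Rightarrow> nat \<Rightarrow> braid_arrow" where
    "symmetric_strict_monoidal_category braid_Obj braid_Hom braid_comp braid_ident (+) braid_tensor 0 \<sigma>"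
    by blast
  then interpret symmetric_strict_monoidal_category
    braid_Obj braid_Hom braid_comp braid_ident "(+)" braid_tensor 0 \<sigma> .
  have obj: "A \<in> braid_Obj" for A
    by (simp add: braid_Obj_def)
  have id: "braid_ident n = (n, braid_class n [])" for n
    by (simp add: braid_ident_def one_braid_group)
  have "\<sigma> 1 1 \<in> braid_Hom 2 2"
    using sym_iso[OF obj obj, of 1 1] by (simp add: iso_def numeral_2_eq_2)
  then obtain u where u: "u \<in> braid_words 2" "\<sigma> 1 1 = (2, braid_class 2 u)"
    by (rule braid_HomE)
  have "braid_class 2 (u @ u) = braid_class 2 []"
    using sym_involutive[OF obj obj, of 1 1] u
    by (simp add: braid_comp_class id numeral_2_eq_2)
  then have "braid_eq 2 (u @ u) []"
    by (rule braid_class_eqD) simp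
  then have \<sigma>11: "\<sigma> 1 1 = braid_ident 2"
    using u(2) braid_class_eqI[OF braid_eq_2_square[OF u(1)]] by (simp add: id)
  \<comment> \<open>Since 2 = 1 + 1, \<open>hexagon1\<close> writes \<open>\<sigma> 1 2\<close> as a
    composite of two tensor products of identities.\<close>
  have \<sigma>12: "\<sigma> 1 2 = braid_ident 3"
    using hexagon1[OF obj obj obj, of 1 1 1] unfolding \<sigma>11
    by (simp add: id braid_tensor_class braid_comp_class shift_word_Nil numeral_eq_Suc)
  have s: "[(0, True)] \<in> braid_words 2"
    by (simp add: braid_words_def)
  have s3: "[(0, True)] \<in> braid_words 3" "[(1, True)] \<in> braid_words 3"
    by (simp_all add: braid_words_def)
  \<comment> \<open>Naturality at the identity of 1 and the crossing on two strands: tensoring with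
    the identity on the left shifts the crossing to position 1, on the right leaves it at 0.\<close>
  have "braid_class 3 [(1, True)] = braid_class 3 [(0, True)]"
    using sym_natural[OF obj obj obj obj ident_in_Hom[OF obj] braid_HomI[OF s], of 1] s s3
    unfolding \<sigma>12
    by (simp add: id braid_tensor_class braid_comp_class shift_word_def numeral_eq_Suc)
  then have "braid_eq 3 [(1, True)] [(0, True)]"
    using s3(1) by (rule braid_class_eqD)
  then have "braid_perm [(1, True)] = braid_perm [(0, True)]"
    by (rule braid_eq_imp_braid_perm_eq)
  \<comment> \<open>The left side is 0, the right side is 1.\<close>
  then have "braid_perm [(1, True)] 0 = braid_perm [(0, True)] 0"
    by simp
  then show False
    by (simp add: transpose_def)
qed

end
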